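(* Let $\mathcal{C}$ be a category with a terminal object $1$, equipped with a factorization system $(\mathcal{L},\mathcal{R})$. Let $\mathcal{L}'\subseteq\mathcal{L}$ be a class of maps which contains all isomorphisms, is stable under composition and pullback, and has the right $\mathcal{L}$-cancellation property. Then the inclusion $$(\mathcal{L}'Obj^{\mathcal{L}})^{op}\hookrightarrow\mathcal{C}^{op}$$ is a stable functor.
   Context: Factorization system means orthogonal factorization system (factorizations unique up to unique isomorphism, unique diagonal fillers). $\mathcal{L}'$ has the right $\mathcal{L}$-cancellation property if for every commutative triangle $f l = l'$ with $l : A\to B$ in $\mathcal{L}$, $l' : A\to C$ in $\mathcal{L}'$ and $f : B\to C$, the map $f$ is in $\mathcal{L}'$. An $\mathcal{L}'$-object is an object $L$ of $\mathcal{C}$ whose terminal map $L\to 1$ is in $\mathcal{L}'$. $\mathcal{L}'Obj^{\mathcal{L}}$ is the subcategory of $\mathcal{C}$ whose objects are the $\mathcal{L}'$-objects and whose morphisms are the $\mathcal{L}$-maps between them. For a functor $U:\mathcal{A}\to\mathcal{B}$, a candidate is a morphism $n : B\to U(A)$ such that for all $f : B\to U(A_1)$ in $\mathcal{B}$ and $u : A\to A_2$, $v : A_1\to A_2$ in $\mathcal{A}$ with $U(v)f = U(u)n$, there is a unique $w : A\to A_1$ in $\mathcal{A}$ with $U(w)n = f$ and $vw = u$. $U$ is stable if every morphism $f : B\to U(A)$ factorizes, uniquely up to unique isomorphism, as $f = U(u_f)n_f$ with $n_f : B\to U(A_f)$ a candidate and $u_f : A_f\to A$ in $\mathcal{A}$.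 *)

theory Defs
  imports Main
begin

section \<open>Categories and functors\<close>

text \<open>
  Objects and arrows are carrier sets inside arbitrary types; the operations are only
  meaningful on these carriers. Composition is in applicative order: \<open>g \<cdot> f\<close> is "f, then g".
\<close>

record ('o, 'm) cat =
  Obj :: "'o set"
  Arr :: "'m set"
  Dom :: "'m \<Rightarrow> 'o"
  Cod :: "'m \<Rightarrow> 'o"
  Id :: "'o \<Rightarrow> 'm"
  Comp :: "'m \<Rightarrow> 'm \<Rightarrow> 'm"  (infixl "\<cdot>\<index>" 70)

definition Hom :: "('o, 'm) cat \<Rightarrow> 'o \<Rightarrow> 'o \<Rightarrow> 'm set" where
  "Hom C x y = {f \<in> Arr C. Dom C f = x \<and> Cod C f = y}"

locale category =
  fixes C :: "('o, 'm) cat" (structure)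
  assumes dom_in_Obj: "f \<in> Arr C \<Longrightarrow> Dom C f \<in> Obj C"
    and cod_in_Obj: "f \<in> Arr C \<Longrightarrow> Cod C f \<in> Obj C"
    and Id_in_Hom: "x \<in> Obj C \<Longrightarrow> Id C x \<in> Hom C x x"
    and Comp_in_Hom: "\<lbrakk>f \<in> Hom C x y; g \<in> Hom C y z\<rbrakk> \<Longrightarrow> g \<cdot> f \<in> Hom C x z"
    and Comp_Id_right: "f \<in> Hom C x y \<Longrightarrow> f \<cdot> Id C x = f"
    and Comp_Id_left: "f \<in> Hom C x y \<Longrightarrow> Id C y \<cdot> f = f"
    and Comp_assoc: "\<lbrakk>f \<in> Hom C w x; g \<in> Hom C x y; h \<in> Hom C y z\<rbrakk>
                       \<Longrightarrow> (h \<cdot> g) \<cdot> f = h \<cdot> (g \<cdot> f)"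

definition op_cat :: "('o, 'm) cat \<Rightarrow> ('o, 'm) cat" where
  "op_cat C = \<lparr>Obj = Obj C, Arr = Arr C, Dom = Cod C, Cod = Dom C, Id = Id C,
               Comp = (\<lambda>g f. f \<cdot>\<^bsub>C\<^esub> g)\<rparr>"

definition is_iso :: "('o, 'm) cat \<Rightarrow> 'o \<Rightarrow> 'o \<Rightarrow> 'm \<Rightarrow> bool" where
  "is_iso C x y f \<longleftrightarrow> x \<in> Obj C \<and> y \<in> Obj C \<and> f \<in> Hom C x y \<and>
     (\<exists>g \<in> Hom C y x. g \<cdot>\<^bsub>C\<^esub> f = Id C x \<and> f \<cdot>\<^bsub>C\<^esub> g = Id C y)"

definition is_terminal :: "('o, 'm) cat \<Rightarrow> 'o \<Rightarrow> bool" where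
  "is_terminal C t \<longleftrightarrow> t \<in> Obj C \<and> (\<forall>x \<in> Obj C. \<exists>!f. f \<in> Hom C x t)"

definition terminal_map :: "('o, 'm) cat \<Rightarrow> 'o \<Rightarrow> 'o \<Rightarrow> 'm" where
  "terminal_map C t x = (THE f. f \<in> Hom C x t)"

text \<open>\<open>p : P \<rightarrow> X\<close> is a pullback of \<open>g : Y \<rightarrow> Z\<close> along \<open>f : X \<rightarrow> Z\<close>, with other projection \<open>q : P \<rightarrow> Y\<close>.\<close>

definition is_pullback ::
  "('o, 'm) cat \<Rightarrow> 'o \<Rightarrow> 'o \<Rightarrow> 'o \<Rightarrow> 'o \<Rightarrow> 'm \<Rightarrow> 'm \<Rightarrow> 'm \<Rightarrow> 'm \<Rightarrow> bool" where
  "is_pullback C P X Y Z p q f g \<longleftrightarrow>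
     p \<in> Hom C P X \<and> q \<in> Hom C P Y \<and> f \<in> Hom C X Z \<and> g \<in> Hom C Y Z \<and>
     f \<cdot>\<^bsub>C\<^esub> p = g \<cdot>\<^bsub>C\<^esub> q \<and>
     (\<forall>W \<in> Obj C. \<forall>a \<in> Hom C W X. \<forall>b \<in> Hom C W Y. f \<cdot>\<^bsub>C\<^esub> a = g \<cdot>\<^bsub>C\<^esub> b \<longrightarrow>
        (\<exists>!h. h \<in> Hom C W P \<and> p \<cdot>\<^bsub>C\<^esub> h = a \<and> q \<cdot>\<^bsub>C\<^esub> h = b))"

record ('o1, 'm1, 'o2, 'm2) funct =
  on_obj :: "'o1 \<Rightarrow> 'o2"
  on_arr :: "'m1 \<Rightarrow> 'm2"

definition is_functor ::
  "('o1, 'm1) cat \<Rightarrow> ('o2, 'm2) cat \<Rightarrow> ('o1, 'm1, 'o2, 'm2) funct \<Rightarrow> bool" where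
  "is_functor A B U \<longleftrightarrow> category A \<and> category B \<and>
     (\<forall>x \<in> Obj A. on_obj U x \<in> Obj B) \<and>
     (\<forall>x \<in> Obj A. \<forall>y \<in> Obj A. \<forall>f \<in> Hom A x y. on_arr U f \<in> Hom B (on_obj U x) (on_obj U y)) \<and>
     (\<forall>x \<in> Obj A. on_arr U (Id A x) = Id B (on_obj U x)) \<and>
     (\<forall>x \<in> Obj A. \<forall>y \<in> Obj A. \<forall>z \<in> Obj A. \<forall>f \<in> Hom A x y. \<forall>g \<in> Hom A y z.
        on_arr U (g \<cdot>\<^bsub>A\<^esub> f) = on_arr U g \<cdot>\<^bsub>B\<^esub> on_arr U f)"

text \<open>
  The inclusion of a subcategory acts as the identity on objects and arrows, and so does its
  opposite; source and target categories are supplied where it is used.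
\<close>

definition inclusion :: "('o, 'm, 'o, 'm) funct" where
  "inclusion = \<lparr>on_obj = (\<lambda>x. x), on_arr = (\<lambda>f. f)\<rparr>"


section \<open>Classes of maps and factorization systems\<close>

definition contains_isos :: "('o, 'm) cat \<Rightarrow> 'm set \<Rightarrow> bool" where
  "contains_isos C S \<longleftrightarrow> (\<forall>x y f. is_iso C x y f \<longrightarrow> f \<in> S)"

definition composition_stable :: "('o, 'm) cat \<Rightarrow> 'm set \<Rightarrow> bool" where
  "composition_stable C S \<longleftrightarrow>
     (\<forall>x y z f g. f \<in> Hom C x y \<longrightarrow> g \<in> Hom C y z \<longrightarrow> f \<in> S \<longrightarrow> g \<in> S \<longrightarrow> g \<cdot>\<^bsub>C\<^esub> f \<in> S)"

text \<open>Stability concerns those pullbacks that exist; the category need not have all pullbacks.\<close>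

definition pullback_stable :: "('o, 'm) cat \<Rightarrow> 'm set \<Rightarrow> bool" where
  "pullback_stable C S \<longleftrightarrow>
     (\<forall>P X Y Z p q f g. is_pullback C P X Y Z p q f g \<longrightarrow> g \<in> S \<longrightarrow> p \<in> S)"

definition right_cancellation :: "('o, 'm) cat \<Rightarrow> 'm set \<Rightarrow> 'm set \<Rightarrow> bool" where
  "right_cancellation C L L' \<longleftrightarrow>
     (\<forall>x y z l l' f. l \<in> Hom C x y \<longrightarrow> l' \<in> Hom C x z \<longrightarrow> f \<in> Hom C y z \<longrightarrow>
        l \<in> L \<longrightarrow> l' \<in> L' \<longrightarrow> f \<cdot>\<^bsub>C\<^esub> l = l' \<longrightarrow> f \<in> L')"

definition is_factorization ::
  "('o, 'm) cat \<Rightarrow> 'm set \<Rightarrow> 'm set \<Rightarrow> 'o \<Rightarrow> 'o \<Rightarrow> 'm \<Rightarrow> 'o \<Rightarrow> 'm \<Rightarrow> 'm \<Rightarrow> bool" where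
  "is_factorization C L R x y f z l r \<longleftrightarrow>
     z \<in> Obj C \<and> l \<in> Hom C x z \<and> l \<in> L \<and> r \<in> Hom C z y \<and> r \<in> R \<and> f = r \<cdot>\<^bsub>C\<^esub> l"

definition factorization_system :: "('o, 'm) cat \<Rightarrow> 'm set \<Rightarrow> 'm set \<Rightarrow> bool" where
  "factorization_system C L R \<longleftrightarrow>
     L \<subseteq> Arr C \<and> R \<subseteq> Arr C \<and>
     contains_isos C L \<and> contains_isos C R \<and>
     composition_stable C L \<and> composition_stable C R \<and>
     \<comment> \<open>factorizations, unique up to unique isomorphism\<close>
     (\<forall>x \<in> Obj C. \<forall>y \<in> Obj C. \<forall>f \<in> Hom C x y.
        (\<exists>z l r. is_factorization C L R x y f z l r) \<and>
        (\<forall>z l r z' l' r'. is_factorization C L R x y f z l r \<longrightarrow>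
           is_factorization C L R x y f z' l' r' \<longrightarrow>
           (\<exists>!i. is_iso C z z' i \<and> i \<cdot>\<^bsub>C\<^esub> l = l' \<and> r' \<cdot>\<^bsub>C\<^esub> i = r))) \<and>
     \<comment> \<open>unique diagonal fillers\<close>
     (\<forall>w x y z. \<forall>l \<in> Hom C w x. \<forall>r \<in> Hom C y z. \<forall>a \<in> Hom C w y. \<forall>b \<in> Hom C x z.
        l \<in> L \<longrightarrow> r \<in> R \<longrightarrow> r \<cdot>\<^bsub>C\<^esub> a = b \<cdot>\<^bsub>C\<^esub> l \<longrightarrow>
        (\<exists>!d. d \<in> Hom C x y \<and> d \<cdot>\<^bsub>C\<^esub> l = a \<and> r \<cdot>\<^bsub>C\<^esub> d = b))"

definition class_objects :: "('o, 'm) cat \<Rightarrow> 'o \<Rightarrow> 'm set \<Rightarrow> 'o set" where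
  "class_objects C t S = {x \<in> Obj C. terminal_map C t x \<in> S}"

text \<open>The category \<open>L'Obj\<^sup>L\<close>, formed with respect to the terminal object \<open>t\<close>.\<close>

definition class_obj_cat ::
  "('o, 'm) cat \<Rightarrow> 'o \<Rightarrow> 'm set \<Rightarrow> 'm set \<Rightarrow> ('o, 'm) cat" where
  "class_obj_cat C t L' L =
     C\<lparr>Obj := class_objects C t L',
       Arr := {f \<in> Arr C. f \<in> L \<and> Dom C f \<in> class_objects C t L' \<and> Cod C f \<in> class_objects C t L'}\<rparr>"


section \<open>Stable functors\<close>

definition is_candidate ::
  "('o1, 'm1) cat \<Rightarrow> ('o2, 'm2) cat \<Rightarrow> ('o1, 'm1, 'o2, 'm2) funct \<Rightarrow> 'o2 \<Rightarrow> 'o1 \<Rightarrow> 'm2 \<Rightarrow> bool"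
  where
  "is_candidate A B U b a n \<longleftrightarrow>
     b \<in> Obj B \<and> a \<in> Obj A \<and> n \<in> Hom B b (on_obj U a) \<and>
     (\<forall>a1 \<in> Obj A. \<forall>a2 \<in> Obj A.
      \<forall>f \<in> Hom B b (on_obj U a1). \<forall>u \<in> Hom A a a2. \<forall>v \<in> Hom A a1 a2.
        on_arr U v \<cdot>\<^bsub>B\<^esub> f = on_arr U u \<cdot>\<^bsub>B\<^esub> n \<longrightarrow>
        (\<exists>!w. w \<in> Hom A a a1 \<and> on_arr U w \<cdot>\<^bsub>B\<^esub> n = f \<and> v \<cdot>\<^bsub>A\<^esub> w = u))"

definition is_stable_factorization ::
  "('o1, 'm1) cat \<Rightarrow> ('o2, 'm2) cat \<Rightarrow> ('o1, 'm1, 'o2, 'm2) funct \<Rightarrow>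
   'o2 \<Rightarrow> 'o1 \<Rightarrow> 'm2 \<Rightarrow> 'o1 \<Rightarrow> 'm2 \<Rightarrow> 'm1 \<Rightarrow> bool" where
  "is_stable_factorization A B U b a f c n u \<longleftrightarrow>
     is_candidate A B U b c n \<and> u \<in> Hom A c a \<and> f = on_arr U u \<cdot>\<^bsub>B\<^esub> n"

definition stable_functor ::
  "('o1, 'm1) cat \<Rightarrow> ('o2, 'm2) cat \<Rightarrow> ('o1, 'm1, 'o2, 'm2) funct \<Rightarrow> bool" where
  "stable_functor A B U \<longleftrightarrow> is_functor A B U \<and>
     (\<forall>b \<in> Obj B. \<forall>a \<in> Obj A. \<forall>f \<in> Hom B b (on_obj U a).
        (\<exists>c n u. is_stable_factorization A B U b a f c n u) \<and>
        (\<forall>c n u c' n' u'. is_stable_factorization A B U b a f c n u \<longrightarrow>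
           is_stable_factorization A B U b a f c' n' u' \<longrightarrow>
           (\<exists>!i. is_iso A c c' i \<and> on_arr U i \<cdot>\<^bsub>B\<^esub> n = n' \<and> u' \<cdot>\<^bsub>A\<^esub> i = u)))"

end

(*
  L is closed under right cancellation, so the unique filler of an L-map against an R-map is itself
  in L when its composite with the L-map is. Hence an R-map out of an L'-object is a candidate for
  the opposite inclusion. Right L-cancellation for L' makes the middle object of the
  (L, R)-factorization of a map out of an L'-object an L'-object, so (L, R)-factorizations are
  stable factorizations; uniqueness of the latter is automatic for every functor.
*)
theory Submission
  imports Defs
begin

section \<open>Access to the axioms of a factorization system\<close>

lemma composition_stableD:
  "\<lbrakk>composition_stable C S; f \<in> Hom C x y; g \<in> Hom C y z; f \<in> S; g \<in> S\<rbrakk> \<Longrightarrow> g \<cdot>\<^bsub>C\<^esub> f \<in> S"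
  unfolding composition_stable_def by blast

lemma factorization_systemD:
  assumes "factorization_system C L R"
  shows "contains_isos C L" "contains_isos C R" "composition_stable C L" "composition_stable C R"
  using assms by (simp_all add: factorization_system_def)

lemma factorization_system_filler:
  assumes "factorization_system C L R"
    and "l \<in> Hom C w x" "l \<in> L" "r \<in> Hom C y z" "r \<in> R" "a \<in> Hom C w y" "b \<in> Hom C x z"
    and "r \<cdot>\<^bsub>C\<^esub> a = b \<cdot>\<^bsub>C\<^esub> l"
  shows "\<exists>!d. d \<in> Hom C x y \<and> d \<cdot>\<^bsub>C\<^esub> l = a \<and> r \<cdot>\<^bsub>C\<^esub> d = b"
proof -
  have "\<forall>w x y z. \<forall>l \<in> Hom C w x. \<forall>r \<in> Hom C y z. \<forall>a \<in> Hom C w y. \<forall>b \<in> Hom C x z.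
        l \<in> L \<longrightarrow> r \<in> R \<longrightarrow> r \<cdot>\<^bsub>C\<^esub> a = b \<cdot>\<^bsub>C\<^esub> l \<longrightarrow>
        (\<exists>!d. d \<in> Hom C x y \<and> d \<cdot>\<^bsub>C\<^esub> l = a \<and> r \<cdot>\<^bsub>C\<^esub> d = b)"
    using assms(1) unfolding factorization_system_def by (elim conjE)
  from this[rule_format, OF assms(2,4,6,7,3,5,8)] show ?thesis .
qed

section \<open>Opposites, terminal maps and cancellation inside a category\<close>

context category
begin

lemma Hom_Obj:
  assumes "f \<in> Hom C x y"
  shows "x \<in> Obj C" "y \<in> Obj C"
  using assms dom_in_Obj cod_in_Obj by (auto simp: Hom_def)

lemma is_iso_Id: "x \<in> Obj C \<Longrightarrow> is_iso C x x (Id C x)"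
  using Id_in_Hom Comp_Id_left by (fastforce simp: is_iso_def)

lemma contains_isos_Id: "\<lbrakk>contains_isos C S; x \<in> Obj C\<rbrakk> \<Longrightarrow> Id C x \<in> S"
  using is_iso_Id unfolding contains_isos_def by blast

lemma Hom_op_cat: "Hom (op_cat C) x y = Hom C y x"
  by (auto simp: Hom_def op_cat_def)

lemma category_op_cat: "category (op_cat C)"
proof (unfold_locales, unfold Hom_op_cat)
  fix f g h w x y z
  assume "f \<in> Hom C x w" "g \<in> Hom C y x" "h \<in> Hom C z y"
  then show "h \<cdot>\<^bsub>op_cat C\<^esub> g \<cdot>\<^bsub>op_cat C\<^esub> f = h \<cdot>\<^bsub>op_cat C\<^esub> (g \<cdot>\<^bsub>op_cat C\<^esub> f)"
    using Comp_assoc[of h z y g x f w] by (simp add: op_cat_def)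
qed (auto simp: op_cat_def dom_in_Obj cod_in_Obj Id_in_Hom
      intro: Comp_in_Hom Comp_Id_left Comp_Id_right)

lemma terminal_map_in_Hom:
  assumes "is_terminal C t" "x \<in> Obj C"
  shows "terminal_map C t x \<in> Hom C x t"
  using assms theI'[of "\<lambda>f. f \<in> Hom C x t"] by (simp add: is_terminal_def terminal_map_def)

lemma Comp_terminal_map:
  assumes "is_terminal C t" "f \<in> Hom C x y"
  shows "terminal_map C t y \<cdot> f = terminal_map C t x"
proof -
  have "terminal_map C t y \<cdot> f \<in> Hom C x t" "terminal_map C t x \<in> Hom C x t"
    using assms terminal_map_in_Hom Hom_Obj Comp_in_Hom by blast+
  then show ?thesis
    using assms Hom_Obj(1)[OF assms(2)] by (auto simp: is_terminal_def)
qed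

text \<open>The terminal map of \<open>y\<close> precomposed with \<open>l\<close> is the terminal
  map of \<open>x\<close>, which lies in \<open>L'\<close>; right cancellation of \<open>l\<close>
  in this triangle leaves the terminal map of \<open>y\<close> in \<open>L'\<close>.\<close>

lemma class_objects_cancel:
  assumes "is_terminal C t" "right_cancellation C L L'"
    and "l \<in> Hom C x y" "l \<in> L" "x \<in> class_objects C t L'"
  shows "y \<in> class_objects C t L'"
  using assms terminal_map_in_Hom[OF assms(1)] Comp_terminal_map[OF assms(1,3)] Hom_Obj[OF assms(3)]
  unfolding right_cancellation_def class_objects_def by blast

lemma factorization_exists:
  assumes "factorization_system C L R" "f \<in> Hom C x y"
  obtains z l r where "is_factorization C L R x y f z l r"
proof -
  have "\<exists>z l r. is_factorization C L R x y f z l r"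
    using assms Hom_Obj[OF assms(2)] by (auto simp: factorization_system_def)
  then show ?thesis using that by blast
qed

lemma factorization_unique:
  assumes "factorization_system C L R" "f \<in> Hom C x y"
    and "is_factorization C L R x y f z l r" "is_factorization C L R x y f z' l' r'"
  shows "\<exists>!i. is_iso C z z' i \<and> i \<cdot> l = l' \<and> r' \<cdot> i = r"
proof -
  have "\<forall>x \<in> Obj C. \<forall>y \<in> Obj C. \<forall>f \<in> Hom C x y.
      (\<exists>z l r. is_factorization C L R x y f z l r) \<and>
      (\<forall>z l r z' l' r'. is_factorization C L R x y f z l r \<longrightarrow>
         is_factorization C L R x y f z' l' r' \<longrightarrow>
         (\<exists>!i. is_iso C z z' i \<and> i \<cdot> l = l' \<and> r' \<cdot> i = r))"
    using assms(1) unfolding factorization_system_def by (elim conjE)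
  from this[rule_format, OF Hom_Obj[OF assms(2)] assms(2), THEN conjunct2, rule_format, OF assms(3,4)]
  show ?thesis .
qed

text \<open>Factor \<open>f = r \<cdot> k\<close>. Then \<open>f \<cdot> l\<close> factors both
  through \<open>m\<close> and, being itself in \<open>L\<close>, trivially through
  \<open>z\<close>. Uniqueness of factorizations forces \<open>r\<close> to be an isomorphism, hence
  an \<open>L\<close>-map, and \<open>f\<close> is a composite of two \<open>L\<close>-maps.\<close>

lemma factorization_system_cancel:
  assumes fs: "factorization_system C L R"
    and l: "l \<in> Hom C x y" "l \<in> L" and f: "f \<in> Hom C y z" and fl: "f \<cdot> l \<in> L"
  shows "f \<in> L"
proof -
  note obj = Hom_Obj[OF l(1)] Hom_Obj[OF f]
  obtain m k r where "is_factorization C L R y z f m k r"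
    by (rule factorization_exists[OF fs f])
  then have k: "k \<in> Hom C y m" "k \<in> L" and r: "r \<in> Hom C m z" "r \<in> R" and frk: "f = r \<cdot> k"
    by (auto simp: is_factorization_def)
  have flH: "f \<cdot> l \<in> Hom C x z" using Comp_in_Hom[OF l(1) f] .
  have "k \<cdot> l \<in> L"
    using composition_stableD[OF factorization_systemD(3)[OF fs] l(1) k(1) l(2) k(2)] .
  then have "is_factorization C L R x z (f \<cdot> l) m (k \<cdot> l) r"
    using r Hom_Obj[OF r(1)] Comp_in_Hom[OF l(1) k(1)] Comp_assoc[OF l(1) k(1) r(1)]
    by (simp add: is_factorization_def frk)
  \<comment> \<open>The identity of \<open>z\<close> serves as right factor: it is an isomorphism,
    hence in \<open>R\<close>.\<close>
  moreover have "is_factorization C L R x z (f \<cdot> l) z (f \<cdot> l) (Id C z)"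
    using contains_isos_Id[OF factorization_systemD(2)[OF fs] obj(4)] fl flH obj(4)
      Id_in_Hom[OF obj(4)] Comp_Id_left[OF flH]
    by (simp add: is_factorization_def)
  ultimately obtain i where i: "is_iso C m z i" "Id C z \<cdot> i = r"
    using factorization_unique[OF fs flH] by blast
  \<comment> \<open>The comparison isomorphism is \<open>r\<close> itself, because the second right
    factor is an identity.\<close>
  have "Id C z \<cdot> i = i" using i(1) Comp_Id_left unfolding is_iso_def by blast
  with i have "is_iso C m z r" by simp
  then have "r \<in> L" using factorization_systemD(1)[OF fs] unfolding contains_isos_def by blast
  then show ?thesis
    using composition_stableD[OF factorization_systemD(3)[OF fs] k(1) r(1) k(2)] frk by simp
qed

section \<open>The subcategory of \<open>L'\<close>-objects and \<open>L\<close>-maps\<close>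

lemma Hom_class_obj_cat:
  "Hom (class_obj_cat C t L' L) x y =
    {f \<in> Hom C x y. f \<in> L \<and> x \<in> class_objects C t L' \<and> y \<in> class_objects C t L'}"
  by (auto simp: Hom_def class_obj_cat_def)

lemma category_class_obj_cat:
  assumes "contains_isos C L" "composition_stable C L"
  shows "category (class_obj_cat C t L' L)"
proof (unfold_locales, unfold Hom_class_obj_cat mem_Collect_eq)
  fix f g h w x y z
  assume "f \<in> Hom C w x \<and> f \<in> L \<and> w \<in> class_objects C t L' \<and> x \<in> class_objects C t L'"
    "g \<in> Hom C x y \<and> g \<in> L \<and> x \<in> class_objects C t L' \<and> y \<in> class_objects C t L'"
    "h \<in> Hom C y z \<and> h \<in> L \<and> y \<in> class_objects C t L' \<and> z \<in> class_objects C t L'"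
  then show "h \<cdot>\<^bsub>class_obj_cat C t L' L\<^esub> g \<cdot>\<^bsub>class_obj_cat C t L' L\<^esub> f =
    h \<cdot>\<^bsub>class_obj_cat C t L' L\<^esub> (g \<cdot>\<^bsub>class_obj_cat C t L' L\<^esub> f)"
    using Comp_assoc[of f w x g y h z] by (simp add: class_obj_cat_def)
next
  fix f g x y z
  assume "f \<in> Hom C x y \<and> f \<in> L \<and> x \<in> class_objects C t L' \<and> y \<in> class_objects C t L'"
    "g \<in> Hom C y z \<and> g \<in> L \<and> y \<in> class_objects C t L' \<and> z \<in> class_objects C t L'"
  then show "g \<cdot>\<^bsub>class_obj_cat C t L' L\<^esub> f \<in> Hom C x z \<and> g \<cdot>\<^bsub>class_obj_cat C t L' L\<^esub> f \<in> L \<and>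
    x \<in> class_objects C t L' \<and> z \<in> class_objects C t L'"
    using composition_stableD[OF assms(2), of f x y g z] Comp_in_Hom[of f x y g z]
    by (simp add: class_obj_cat_def)
next
  fix x
  assume "x \<in> Obj (class_obj_cat C t L' L)"
  then have "x \<in> class_objects C t L'" by (simp add: class_obj_cat_def)
  moreover from this have "x \<in> Obj C" by (simp add: class_objects_def)
  ultimately show "Id (class_obj_cat C t L' L) x \<in> Hom C x x \<and> Id (class_obj_cat C t L' L) x \<in> L \<and>
    x \<in> class_objects C t L' \<and> x \<in> class_objects C t L'"
    using contains_isos_Id[OF assms(1)] Id_in_Hom by (simp add: class_obj_cat_def)
qed (auto simp: class_obj_cat_def intro: Comp_Id_left Comp_Id_right)

end

section \<open>Uniqueness of stable factorizations for an arbitrary functor\<close>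

lemma is_candidateD:
  assumes "is_candidate A B U b a n" "a1 \<in> Obj A" "a2 \<in> Obj A"
    and "f \<in> Hom B b (on_obj U a1)" "u \<in> Hom A a a2" "v \<in> Hom A a1 a2"
    and "on_arr U v \<cdot>\<^bsub>B\<^esub> f = on_arr U u \<cdot>\<^bsub>B\<^esub> n"
  shows "\<exists>!w. w \<in> Hom A a a1 \<and> on_arr U w \<cdot>\<^bsub>B\<^esub> n = f \<and> v \<cdot>\<^bsub>A\<^esub> w = u"
  using assms unfolding is_candidate_def by blast

text \<open>The universal property of each candidate yields a map to the other factorization. The
  composites of these maps are comparisons of a factorization with itself, as are the identities, so
  uniqueness of comparisons makes the two maps mutually inverse.\<close>

lemma stable_factorization_unique:
  assumes U: "is_functor A B U" and "a \<in> Obj A"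
    and F: "is_stable_factorization A B U b a f c n u"
    and F': "is_stable_factorization A B U b a f c' n' u'"
  shows "\<exists>!i. is_iso A c c' i \<and> on_arr U i \<cdot>\<^bsub>B\<^esub> n = n' \<and> u' \<cdot>\<^bsub>A\<^esub> i = u"
proof -
  interpret A: category A using U by (simp add: is_functor_def)
  interpret B: category B using U by (simp add: is_functor_def)
  \<comment> \<open>The candidate property with \<open>a1 = y\<close> and \<open>a2 = a\<close>:
    both composites in its square equal \<open>f\<close>, so the square commutes.\<close>
  have comparison: "\<exists>!w. w \<in> Hom A x y \<and> on_arr U w \<cdot>\<^bsub>B\<^esub> p = q \<and> v \<cdot>\<^bsub>A\<^esub> w = k"
    if "is_stable_factorization A B U b a f x p k" "is_stable_factorization A B U b a f y q v"
    for x p k y q v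
  proof (rule is_candidateD)
    show "is_candidate A B U b x p"
      using that(1) by (simp add: is_stable_factorization_def)
    show "a \<in> Obj A" by fact
    show "y \<in> Obj A" "q \<in> Hom B b (on_obj U y)" "k \<in> Hom A x a" "v \<in> Hom A y a"
      "on_arr U v \<cdot>\<^bsub>B\<^esub> q = on_arr U k \<cdot>\<^bsub>B\<^esub> p"
      using that unfolding is_stable_factorization_def is_candidate_def by simp_all
  qed
  have inverse: "w' \<cdot>\<^bsub>A\<^esub> w = Id A x"
    if "is_stable_factorization A B U b a f x p k" "is_stable_factorization A B U b a f y q v"
      and w: "w \<in> Hom A x y" "on_arr U w \<cdot>\<^bsub>B\<^esub> p = q" "v \<cdot>\<^bsub>A\<^esub> w = k"
      and w': "w' \<in> Hom A y x" "on_arr U w' \<cdot>\<^bsub>B\<^esub> q = p" "k \<cdot>\<^bsub>A\<^esub> w' = v"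
    for x p k y q v w w'
  proof -
    have x: "x \<in> Obj A" and y: "y \<in> Obj A" and p: "p \<in> Hom B b (on_obj U x)" and k: "k \<in> Hom A x a"
      using that(1,2) by (auto simp: is_stable_factorization_def is_candidate_def)
    have Uw: "on_arr U w \<in> Hom B (on_obj U x) (on_obj U y)"
      and Uw': "on_arr U w' \<in> Hom B (on_obj U y) (on_obj U x)"
      and Uc: "on_arr U (w' \<cdot>\<^bsub>A\<^esub> w) = on_arr U w' \<cdot>\<^bsub>B\<^esub> on_arr U w"
      and Ui: "on_arr U (Id A x) = Id B (on_obj U x)"
      using U x y w(1) w'(1) unfolding is_functor_def by blast+
    \<comment> \<open>Functoriality of \<open>U\<close> lets the two triangles over \<open>b\<close>
      be pasted, and likewise the two over \<open>a\<close>, so the composite compares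
      \<open>(x, p, k)\<close> with itself.\<close>
    have "w' \<cdot>\<^bsub>A\<^esub> w \<in> Hom A x x" "on_arr U (w' \<cdot>\<^bsub>A\<^esub> w) \<cdot>\<^bsub>B\<^esub> p = p" "k \<cdot>\<^bsub>A\<^esub> (w' \<cdot>\<^bsub>A\<^esub> w) = k"
      using A.Comp_in_Hom[OF w(1) w'(1)] B.Comp_assoc[OF p Uw Uw'] A.Comp_assoc[OF w(1) w'(1) k]
      by (simp_all add: Uc w w')
    moreover have "Id A x \<in> Hom A x x" "on_arr U (Id A x) \<cdot>\<^bsub>B\<^esub> p = p" "k \<cdot>\<^bsub>A\<^esub> Id A x = k"
      using A.Id_in_Hom[OF x] B.Comp_Id_left[OF p] A.Comp_Id_right[OF k] by (simp_all add: Ui)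
    ultimately show ?thesis
      using comparison[OF that(1,1)] by blast
  qed
  obtain w where w: "w \<in> Hom A c c'" "on_arr U w \<cdot>\<^bsub>B\<^esub> n = n'" "u' \<cdot>\<^bsub>A\<^esub> w = u"
    using comparison[OF F F'] by blast
  obtain w' where w': "w' \<in> Hom A c' c" "on_arr U w' \<cdot>\<^bsub>B\<^esub> n' = n" "u \<cdot>\<^bsub>A\<^esub> w' = u'"
    using comparison[OF F' F] by blast
  \<comment> \<open>\<open>inverse\<close> is used in both directions, once for each
    composite.\<close>
  have "is_iso A c c' w"
    using w(1) w'(1) A.Hom_Obj[OF w(1)] inverse[OF F F' w w'] inverse[OF F' F w' w]
    by (auto simp: is_iso_def)
  \<comment> \<open>The map \<open>w\<close> is unique among all comparisons, hence also among the
    invertible ones.\<close>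
  then show ?thesis
    using w comparison[OF F F'] unfolding is_iso_def by blast
qed

section \<open>The opposite inclusion and its candidates\<close>

lemma is_functor_op_inclusion:
  assumes "category C" "contains_isos C L" "composition_stable C L"
  shows "is_functor (op_cat (class_obj_cat C t L' L)) (op_cat C) inclusion"
proof -
  interpret category C by fact
  interpret S: category "class_obj_cat C t L' L" by (rule category_class_obj_cat) fact+
  have "x \<in> Obj C" if "x \<in> class_objects C t L'" for x
    using that by (simp add: class_objects_def)
  then show ?thesis
    unfolding is_functor_def Hom_op_cat S.Hom_op_cat Hom_class_obj_cat
    by (intro conjI category_op_cat S.category_op_cat)
      (simp_all add: inclusion_def op_cat_def class_obj_cat_def)
qed

text \<open>Read in \<open>C\<close>, the condition on a candidate concerns a square
  \<open>f v = r u\<close> with \<open>v\<close> in \<open>L\<close> and \<open>r\<close> in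
  \<open>R\<close>: the required \<open>w\<close> is its diagonal filler, with the extra demand that
  \<open>w\<close> be an \<open>L\<close>-map.\<close>

lemma R_map_is_candidate:
  assumes "category C" and fs: "factorization_system C L R"
    and r: "r \<in> Hom C c b" "r \<in> R" and c: "c \<in> class_objects C t L'"
  shows "is_candidate (op_cat (class_obj_cat C t L' L)) (op_cat C) inclusion b c r"
proof -
  interpret category C by fact
  interpret S: category "class_obj_cat C t L' L"
    by (rule category_class_obj_cat[OF factorization_systemD(1,3)[OF fs]])
  have filler: "\<exists>!w. w \<in> Hom C x c \<and> w \<in> L \<and> r \<cdot>\<^bsub>C\<^esub> w = f \<and> w \<cdot>\<^bsub>C\<^esub> v = u"
    if f: "f \<in> Hom C x b"
      and u: "u \<in> Hom C y c" "u \<in> L" and v: "v \<in> Hom C y x" "v \<in> L"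
      and eq: "f \<cdot>\<^bsub>C\<^esub> v = r \<cdot>\<^bsub>C\<^esub> u" for x y f u v
  proof -
    have "\<exists>!d. d \<in> Hom C x c \<and> d \<cdot>\<^bsub>C\<^esub> v = u \<and> r \<cdot>\<^bsub>C\<^esub> d = f"
      using factorization_system_filler[OF fs v r u(1) f eq[symmetric]] .
    \<comment> \<open>Both \<open>v\<close> and \<open>d v = u\<close> lie in \<open>L\<close>, so
      cancellation puts any filler in \<open>L\<close>. Unique existence among all maps thus passes
      to unique existence among \<open>L\<close>-maps.\<close>
    moreover have "d \<in> L" if "d \<in> Hom C x c" "d \<cdot>\<^bsub>C\<^esub> v = u" for d
      using factorization_system_cancel[OF fs v that(1)] that(2) u(2) by simp
    ultimately show ?thesis by blast
  qed
  show ?thesis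
    using r c Hom_Obj[OF r(1)]
    unfolding is_candidate_def Hom_op_cat S.Hom_op_cat Hom_class_obj_cat
    by (simp add: inclusion_def op_cat_def class_obj_cat_def)
      (intro ballI allI impI, elim conjE, rule filler)
qed

theorem proposition5p6:
  fixes C :: "('o, 'm) cat" and one :: 'o and L R L' :: "'m set"
  assumes "category C"
    and "is_terminal C one"
    and "factorization_system C L R"
    and "L' \<subseteq> L"
    and "contains_isos C L'"
    and "composition_stable C L'"
    and "pullback_stable C L'"
    and "right_cancellation C L L'"
  shows "stable_functor (op_cat (class_obj_cat C one L' L)) (op_cat C) inclusion"
proof -
  let ?S = "class_obj_cat C one L' L"
  interpret category C by fact
  interpret S: category ?S
    by (rule category_class_obj_cat[OF factorization_systemD(1,3)[OF assms(3)]])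
  have U: "is_functor (op_cat ?S) (op_cat C) inclusion"
    by (rule is_functor_op_inclusion[OF assms(1) factorization_systemD(1,3)[OF assms(3)]])
  have "\<exists>c n u. is_stable_factorization (op_cat ?S) (op_cat C) inclusion b a f c n u"
    if "a \<in> Obj (op_cat ?S)" "f \<in> Hom (op_cat C) b (on_obj inclusion a)" for a b f
  proof -
    have a: "a \<in> class_objects C one L'" and f: "f \<in> Hom C a b"
      using that unfolding Hom_op_cat by (simp_all add: inclusion_def op_cat_def class_obj_cat_def)
    obtain c l r where "is_factorization C L R a b f c l r"
      by (rule factorization_exists[OF assms(3) f])
    then have l: "l \<in> Hom C a c" "l \<in> L" and r: "r \<in> Hom C c b" "r \<in> R" and eq: "f = r \<cdot>\<^bsub>C\<^esub> l"
      by (auto simp: is_factorization_def)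
    \<comment> \<open>The left factor \<open>l\<close> starts at an \<open>L'\<close>-object, so
      cancellation along it makes \<open>c\<close> an object of the subcategory.\<close>
    have c: "c \<in> class_objects C one L'"
      using class_objects_cancel[OF assms(2,8) l a] .
    \<comment> \<open>Passing to opposites exchanges the roles of the factors: \<open>r\<close>
      becomes the candidate out of \<open>b\<close>, and \<open>l\<close> the morphism
      \<open>c\<close> to \<open>a\<close> of the opposite subcategory.\<close>
    have "is_stable_factorization (op_cat ?S) (op_cat C) inclusion b a f c r l"
      using R_map_is_candidate[OF assms(1,3) r c] l a c eq
      unfolding is_stable_factorization_def S.Hom_op_cat Hom_class_obj_cat
      by (simp add: inclusion_def op_cat_def)
    then show ?thesis by blast
  qed
  then show ?thesis
    unfolding stable_functor_def
    using U stable_factorization_unique[OF U] by blast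
qed

end
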